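(* For every $n\in\mathbb{N}$ with $n\ge 2$ and every $\rho\in(0,1)$, there exists a linear transformation $A\in\mathbb{R}^{n\times n}$ with spectral radius $\rho(A)=\rho$ and $\|A^{n-1}\|>1$.
   Context: $\|\cdot\|$ is the operator norm induced by the Euclidean norm. *)

theory Defs
  imports "HOL-Analysis.L2_Norm" "Jordan_Normal_Form.Spectral_Radius"
begin

definition vec_l2_norm :: "real vec \<Rightarrow> real" where
  "vec_l2_norm v = L2_set (\<lambda>i. v $ i) {0..<dim_vec v}"

text \<open>Same shape as the library's onorm, which needs a normed type and so
  does not apply to \<^typ>\<open>real vec\<close>. As there, the zero vector contributes 0 / 0 = 0.\<close>

definition mat_op_norm :: "real mat \<Rightarrow> real" where
  "mat_op_norm A =
     (SUP v\<in>carrier_vec (dim_col A). vec_l2_norm (A *\<^sub>v v) / vec_l2_norm v)"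

text \<open>\<^const>\<open>spectral_radius\<close> takes complex matrices: the complex eigenvalues of a real
  matrix count.\<close>

definition real_mat_spectral_radius :: "real mat \<Rightarrow> real" where
  "real_mat_spectral_radius A = spectral_radius (map_mat complex_of_real A)"

lemma vec_l2_norm_mult_mat_vec_le:
  assumes "v \<in> carrier_vec (dim_col A)"
  shows "vec_l2_norm (A *\<^sub>v v) \<le> (\<Sum>i = 0..<dim_row A. vec_l2_norm (row A i)) * vec_l2_norm v"
proof -
  have row: "\<bar>(A *\<^sub>v v) $ i\<bar> \<le> vec_l2_norm (row A i) * vec_l2_norm v"
    if i: "i < dim_row A" for i
  proof -
    have "\<bar>(A *\<^sub>v v) $ i\<bar> = \<bar>\<Sum>j = 0..<dim_col A. row A i $ j * v $ j\<bar>"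
      using assms i by (simp add: scalar_prod_def)
    also have "\<dots> \<le> (\<Sum>j = 0..<dim_col A. \<bar>row A i $ j\<bar> * \<bar>v $ j\<bar>)"
      unfolding abs_mult[symmetric] by (rule sum_abs)
    also have "\<dots> \<le> vec_l2_norm (row A i) * vec_l2_norm v"
      using assms L2_set_mult_ineq[of "\<lambda>j. row A i $ j" "\<lambda>j. v $ j" "{0..<dim_col A}"]
      by (simp add: vec_l2_norm_def)
    finally show ?thesis .
  qed
  have "vec_l2_norm (A *\<^sub>v v) \<le> (\<Sum>i = 0..<dim_row A. \<bar>(A *\<^sub>v v) $ i\<bar>)"
    using L2_set_le_sum_abs[of "\<lambda>i. (A *\<^sub>v v) $ i" "{0..<dim_row A}"]
    unfolding vec_l2_norm_def dim_mult_mat_vec .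
  also have "\<dots> \<le> (\<Sum>i = 0..<dim_row A. vec_l2_norm (row A i) * vec_l2_norm v)"
    using row by (intro sum_mono) auto
  finally show ?thesis by (simp add: sum_distrib_right)
qed

text \<open>The real supremum in \<^const>\<open>mat_op_norm\<close> is always over a bounded set.\<close>

lemma bdd_above_mat_op_norm:
  "bdd_above ((\<lambda>v. vec_l2_norm (A *\<^sub>v v) / vec_l2_norm v) ` carrier_vec (dim_col A))"
proof (rule bdd_aboveI2)
  fix v :: "real vec" assume v: "v \<in> carrier_vec (dim_col A)"
  have nonneg: "vec_l2_norm w \<ge> 0" for w by (simp add: vec_l2_norm_def)
  show "vec_l2_norm (A *\<^sub>v v) / vec_l2_norm v
      \<le> (\<Sum>i = 0..<dim_row A. vec_l2_norm (row A i))"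
    using vec_l2_norm_mult_mat_vec_le[OF v] nonneg
    by (cases "vec_l2_norm v = 0") (auto simp: pos_divide_le_eq sum_nonneg less_le)
qed

end

theory Submission
  imports Defs
begin

text \<open>The Jordan block of size \<open>n\<close> with eigenvalue \<open>\<rho>\<close> works: the last column of its
  \<open>(n - 1)\<close>-st power starts with the entries \<open>1\<close> and \<open>(n - 1) \<rho> \<noteq> 0\<close>, so its
  Euclidean norm, a lower bound for the operator norm, exceeds \<open>1\<close>.\<close>

text \<open>Column \<open>j\<close> is the image of the \<open>j\<close>-th unit vector, which has
  norm 1, so its norm is one of the quotients in the supremum.\<close>

lemma vec_l2_norm_col_le_mat_op_norm:
  assumes j: "j < dim_col A"
  shows "vec_l2_norm (col A j) \<le> mat_op_norm A"
proof -
  let ?e = "unit_vec (dim_col A) j :: real vec"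
  have "A *\<^sub>v ?e = col A j"
    using j by (intro eq_vecI) auto
  moreover have "vec_l2_norm ?e = 1"
    using j by (simp add: vec_l2_norm_def L2_set_def unit_vec_def
      if_distrib[of "\<lambda>x. x\<^sup>2"] cong: if_cong)
  ultimately show ?thesis
    using cSUP_upper[OF _ bdd_above_mat_op_norm, of ?e A] by (simp add: mat_op_norm_def)
qed

text \<open>The characteristic polynomial is the \<open>n\<close>-th power of \<open>X - a\<close>;
  since \<open>n > 0\<close>, its only root is \<open>a\<close>.\<close>

lemma spectral_radius_jordan_block:
  assumes "n > 0"
  shows "spectral_radius (jordan_block n a) = norm a"
proof -
  have "spectrum (jordan_block n a) = {a}"
    using assms by (auto simp: spectrum_def eigenvalue_root_char_poly[OF jordan_block_carrier]
      jordan_block_char_poly poly_power)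
  then show ?thesis by (simp add: spectral_radius_def)
qed

lemma map_mat_of_real_jordan_block:
  "map_mat of_real (jordan_block n a) = jordan_block n (of_real a)"
  by (intro eq_matI) (auto simp: jordan_block_def)

theorem theorem4:
  fixes n :: nat and \<rho> :: real
  assumes "n \<ge> 2" and "0 < \<rho>" and "\<rho> < 1"
  shows "\<exists>A :: real mat. A \<in> carrier_mat n n \<and> real_mat_spectral_radius A = \<rho> \<and>
           mat_op_norm (A ^\<^sub>m (n - 1)) > 1"
proof (intro exI conjI)
  let ?J = "jordan_block n \<rho>"
  let ?c = "col (?J ^\<^sub>m (n - 1)) (n - 1)"
  show "?J \<in> carrier_mat n n" by simp
  show "real_mat_spectral_radius ?J = \<rho>"
    using assms by (simp add: real_mat_spectral_radius_def map_mat_of_real_jordan_block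
      spectral_radius_jordan_block)
  \<comment> \<open>Entry \<open>i\<close> of \<open>?c\<close> is
    \<open>(n - 1 choose (n - 1 - i)) * \<rho> ^ i\<close>; this is the coefficient for
    \<open>i = 1\<close>.\<close>
  have "n - 1 choose (n - 2) = n - 1"
    using assms binomial_symmetric[of 1 "n - 1"] by (simp add: numeral_2_eq_2)
  then have c0: "?c $ 0 = 1" and c1: "?c $ 1 = real (n - 1) * \<rho>"
    using assms by (auto simp: jordan_block_pow numeral_2_eq_2)
  have "1 < (?c $ 0)\<^sup>2 + (?c $ 1)\<^sup>2"
    using assms unfolding c0 c1 by simp
  also have "\<dots> = (\<Sum>i\<in>{0, 1}. (?c $ i)\<^sup>2)" by simp
  \<comment> \<open>Both 0 and 1 are indices of \<open>?c\<close> because \<open>n \<ge> 2\<close>;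
    the added terms are squares.\<close>
  also have "\<dots> \<le> (\<Sum>i = 0..<dim_vec ?c. (?c $ i)\<^sup>2)"
    using assms by (intro sum_mono2) (auto simp: jordan_block_pow)
  finally have "1 < vec_l2_norm ?c"
    by (simp add: vec_l2_norm_def L2_set_def)
  also have "\<dots> \<le> mat_op_norm (?J ^\<^sub>m (n - 1))"
    using assms by (intro vec_l2_norm_col_le_mat_op_norm) (simp add: jordan_block_pow)
  finally show "mat_op_norm (?J ^\<^sub>m (n - 1)) > 1" .
qed

end
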